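(* Let $u$ be an entire or meromorphic function on $\mathbb{C}$ and let $A=u(z)\frac{d}{dz}$. For every $k=1,2,\dots$ the operator $A^{k}$ is given by $$A^{k}=\sum_{m=0}^{k}\ \sum_{m,k}C_k(\alpha)\,[A^{0}u]^{\alpha_1}[A^{1}u]^{\alpha_2}\cdots[A^{k-1}u]^{\alpha_k}\Big(\frac{d}{dz}\Big)^{m}.$$
   Context: $\sum_{m,k}$ denotes summation over all tuples $\alpha=(\alpha_1,\dots,\alpha_k)$ of nonnegative integers with $\sum_{i=1}^k\alpha_i=m$ and $\sum_{i=1}^k i\alpha_i=k$, and $$C_k(\alpha)=\frac{k!}{(1!)^{\alpha_1}\cdots(k!)^{\alpha_k}\,\alpha_1!\cdots\alpha_k!}.$$ Here $A^0u=u$, and $A^{j}u$ is the function obtained by applying $A$ to $u$ successively $j$ times. Operators act on entire and meromorphic functions on $\mathbb{C}$. *)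

theory Defs
  imports "HOL-Complex_Analysis.Complex_Analysis"
begin

(* The operator u(z) d/dz. On a meromorphic representative, deriv takes an arbitrary value at the
   exceptional (sparse) points, so identities between meromorphic functions are stated on a
   cosparse set. *)
definition vfield :: "(complex \<Rightarrow> complex) \<Rightarrow> (complex \<Rightarrow> complex) \<Rightarrow> complex \<Rightarrow> complex" where
  "vfield u f = (\<lambda>z. u z * deriv f z)"

lemma vfield_meromorphic_on [meromorphic_intros]:
  "u meromorphic_on S \<Longrightarrow> f meromorphic_on S \<Longrightarrow> vfield u f meromorphic_on S"
  unfolding vfield_def by (intro meromorphic_intros)

(* A tuple (alpha_1, ..., alpha_k) is an extensional function on {1..k}. *)
definition index_tuples :: "nat \<Rightarrow> nat \<Rightarrow> (nat \<Rightarrow> nat) set" where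
  "index_tuples m k =
     {\<alpha> \<in> {1..k} \<rightarrow>\<^sub>E UNIV. (\<Sum>i=1..k. \<alpha> i) = m \<and> (\<Sum>i=1..k. i * \<alpha> i) = k}"

definition partition_coeff :: "nat \<Rightarrow> (nat \<Rightarrow> nat) \<Rightarrow> complex" where
  "partition_coeff k \<alpha> = fact k / ((\<Prod>i=1..k. fact i ^ \<alpha> i) * (\<Prod>i=1..k. fact (\<alpha> i)))"

(* The right-hand side operator; the i-th factor is (A^(i-1) u)^(alpha_i) with A = u d/dz. *)
definition vfield_expansion ::
  "(complex \<Rightarrow> complex) \<Rightarrow> nat \<Rightarrow> (complex \<Rightarrow> complex) \<Rightarrow> complex \<Rightarrow> complex" where
  "vfield_expansion u k f = (\<lambda>z. \<Sum>m=0..k. \<Sum>\<alpha>\<in>index_tuples m k.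
     partition_coeff k \<alpha> * (\<Prod>i=1..k. ((vfield u ^^ (i - 1)) u z) ^ \<alpha> i) * (deriv ^^ m) f z)"

lemma finite_index_tuples: "finite (index_tuples m k)"
proof (rule finite_subset)
  show "index_tuples m k \<subseteq> {1..k} \<rightarrow>\<^sub>E {..m}"
  proof
    fix \<alpha> assume a: "\<alpha> \<in> index_tuples m k"
    have "\<alpha> i \<le> m" if "i \<in> {1..k}" for i
      using a member_le_sum[of i "{1..k}" \<alpha>] that by (auto simp: index_tuples_def)
    then show "\<alpha> \<in> {1..k} \<rightarrow>\<^sub>E {..m}"
      using a by (auto simp: index_tuples_def PiE_iff)
  qed
qed (intro finite_PiE; simp)

end

theory Submission
  imports Defs
begin

text \<open>
  Put \<open>x\<^sub>i = A\<^sup>i\<^sup>-\<^sup>1 u\<close> and \<open>X = \<Sum>\<^sub>i\<^sub>\<ge>\<^sub>1 x\<^sub>i t\<^sup>i / i!\<close>, a formal power series in \<open>t\<close> with meromorphic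
  coefficients. Since \<open>A x\<^sub>i = x\<^sub>i\<^sub>+\<^sub>1\<close>, applying \<open>A\<close> coefficientwise gives \<open>A X = dX/dt - u\<close>, hence
  \<open>A (X\<^sup>m / m!) = d/dt (X\<^sup>m / m!) - u X\<^sup>m\<^sup>-\<^sup>1 / (m-1)!\<close>. Comparing coefficients of \<open>t\<^sup>k / k!\<close>
  yields exactly the recurrence in \<open>k\<close> of the coefficients of \<open>A\<^sup>k\<close> with respect to the powers of
  \<open>d/dz\<close>. The multinomial theorem expands \<open>X\<^sup>m / m!\<close> into the sum over tuples.
\<close>

text \<open>Lets the infinite series \<open>X\<close> be cut off after degree \<open>k\<close> when
  only the coefficient of degree \<open>k\<close> of a power is wanted.\<close>

lemma fps_power_nth_cong:
  fixes F G :: "'a::comm_semiring_1 fps"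
  assumes "\<And>i. i \<le> n \<Longrightarrow> fps_nth F i = fps_nth G i"
  shows "fps_nth (F ^ m) n = fps_nth (G ^ m) n"
  using assms
proof (induction m arbitrary: n)
  case (Suc m)
  have "fps_nth (F * F ^ m) n = fps_nth (G * G ^ m) n"
    unfolding fps_mult_nth using Suc by (intro sum.cong refl arg_cong2[where f = "(*)"]) auto
  then show ?case by simp
qed simp

text \<open>Decouples the length \<open>n\<close> from the weight \<open>k\<close>, which makes
  induction on \<open>n\<close> possible; \<open>index_tuples m k\<close> is the case
  \<open>n = k\<close>.\<close>

definition weighted_tuples :: "nat \<Rightarrow> nat \<Rightarrow> nat \<Rightarrow> (nat \<Rightarrow> nat) set" where
  "weighted_tuples n m k =
     {\<alpha> \<in> {1..n} \<rightarrow>\<^sub>E UNIV. (\<Sum>i=1..n. \<alpha> i) = m \<and> (\<Sum>i=1..n. i * \<alpha> i) = k}"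

lemma finite_weighted_tuples: "finite (weighted_tuples n m k)"
proof (rule finite_subset)
  show "weighted_tuples n m k \<subseteq> {1..n} \<rightarrow>\<^sub>E {..m}"
  proof
    fix \<alpha> assume a: "\<alpha> \<in> weighted_tuples n m k"
    have "\<alpha> i \<le> m" if "i \<in> {1..n}" for i
      using a member_le_sum[of i "{1..n}" \<alpha>] that by (auto simp: weighted_tuples_def)
    then show "\<alpha> \<in> {1..n} \<rightarrow>\<^sub>E {..m}"
      using a by (auto simp: weighted_tuples_def PiE_iff)
  qed
qed (intro finite_PiE; simp)

text \<open>Split each tuple by its last entry \<open>j\<close>; the rest has sum
  \<open>m - j\<close> and weight \<open>k - Suc n * j\<close>. The two bounds on \<open>j\<close>
  keep these natural subtractions exact.\<close>

lemma sum_weighted_tuples_Suc: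
  fixes g :: "nat \<Rightarrow> nat \<Rightarrow> 'a::comm_semiring_1"
  shows "(\<Sum>\<alpha>\<in>weighted_tuples (Suc n) m k. \<Prod>i=1..Suc n. g i (\<alpha> i)) =
    (\<Sum>j | j \<le> m \<and> Suc n * j \<le> k.
       g (Suc n) j * (\<Sum>\<alpha>\<in>weighted_tuples n (m - j) (k - Suc n * j). \<Prod>i=1..n. g i (\<alpha> i)))"
proof -
  have "(\<Sum>\<alpha>\<in>weighted_tuples (Suc n) m k. \<Prod>i=1..Suc n. g i (\<alpha> i)) =
    (\<Sum>(j, \<alpha>) \<in> (SIGMA j:{j. j \<le> m \<and> Suc n * j \<le> k}. weighted_tuples n (m - j) (k - Suc n * j)).
       g (Suc n) j * (\<Prod>i=1..n. g i (\<alpha> i)))"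
  proof (rule sum.reindex_bij_witness
      [where i = "\<lambda>(j, \<alpha>). \<alpha>(Suc n := j)" and j = "\<lambda>\<alpha>. (\<alpha> (Suc n), restrict \<alpha> {1..n})"], goal_cases)
    case (1 \<alpha>)
    then show ?case
      by (auto simp: weighted_tuples_def fun_eq_iff PiE_iff extensional_def restrict_def le_Suc_eq)
  next
    case (2 \<alpha>)
    then show ?case
      by (auto simp: weighted_tuples_def)
  next
    case (3 p)
    then show ?case
      by (auto simp: weighted_tuples_def fun_eq_iff PiE_iff extensional_def restrict_def)
  next
    case (4 p)
    then show ?case
      by (auto simp: weighted_tuples_def PiE_iff extensional_def)
  next
    case (5 \<alpha>)
    then show ?case
      by (auto simp: mult.commute)
  qed
  also have "\<dots> = (\<Sum>j | j \<le> m \<and> Suc n * j \<le> k.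
       \<Sum>\<alpha>\<in>weighted_tuples n (m - j) (k - Suc n * j). g (Suc n) j * (\<Prod>i=1..n. g i (\<alpha> i)))"
    by (rule sum.Sigma[symmetric]) (auto intro: finite_weighted_tuples)
  finally show ?thesis by (simp add: sum_distrib_left)
qed

text \<open>Induction on the number of summands: the binomial theorem splits off the last one, whose
  power \<open>fps_X ^ (Suc n * j)\<close> shifts the coefficient index and kills the term when
  \<open>Suc n * j\<close> exceeds \<open>k\<close>.\<close>

lemma fps_power_nth_multinomial:
  fixes y :: "nat \<Rightarrow> 'a::field_char_0"
  shows "fps_nth ((\<Sum>i=1..n. fps_const (y i) * fps_X ^ i) ^ m) k / fact m =
    (\<Sum>\<alpha>\<in>weighted_tuples n m k. \<Prod>i=1..n. y i ^ \<alpha> i / fact (\<alpha> i))"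
proof (induction n arbitrary: m k)
  case 0
  have "weighted_tuples 0 m k = (if m = 0 \<and> k = 0 then {\<lambda>_. undefined} else {})"
    by (auto simp: weighted_tuples_def)
  then show ?case by (auto simp: power_0_left)
next
  case (Suc n)
  define F where "F = (\<Sum>i=1..n. fps_const (y i) * fps_X ^ i)"
  have "fps_nth ((\<Sum>i=1..Suc n. fps_const (y i) * fps_X ^ i) ^ m) k / fact m =
        fps_nth ((fps_const (y (Suc n)) * fps_X ^ Suc n + F) ^ m) k / fact m"
    by (simp add: F_def add.commute)
  also have "\<dots> = (\<Sum>j\<le>m. fps_nth (of_nat (m choose j) *
      (fps_const (y (Suc n)) * fps_X ^ Suc n) ^ j * F ^ (m - j)) k) / fact m"
    by (simp only: binomial_ring fps_sum_nth)
  also have "\<dots> = (\<Sum>j\<le>m. if Suc n * j \<le> k then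
      y (Suc n) ^ j / fact j * (fps_nth (F ^ (m - j)) (k - Suc n * j) / fact (m - j)) else 0)"
    unfolding sum_divide_distrib
  proof (intro sum.cong refl)
    fix j assume "j \<in> {..m}"
    then have b: "of_nat (m choose j) = (fact m / (fact j * fact (m - j)) :: 'a)"
      by (simp add: binomial_fact)
    have "of_nat (m choose j) * (fps_const (y (Suc n)) * fps_X ^ Suc n) ^ j * F ^ (m - j) =
      fps_const (of_nat (m choose j) * y (Suc n) ^ j) * (fps_X ^ (Suc n * j) * F ^ (m - j))"
      by (simp only: power_mult_distrib fps_const_power power_mult fps_of_nat [symmetric]
          fps_const_mult [symmetric] mult.assoc)
    then show "fps_nth (of_nat (m choose j) *
        (fps_const (y (Suc n)) * fps_X ^ Suc n) ^ j * F ^ (m - j)) k / fact m =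
      (if Suc n * j \<le> k then
        y (Suc n) ^ j / fact j * (fps_nth (F ^ (m - j)) (k - Suc n * j) / fact (m - j)) else 0)"
      by (simp only: fps_mult_left_const_nth fps_X_power_mult_nth b) (simp add: field_simps)
  qed
  also have "\<dots> = (\<Sum>j | j \<le> m \<and> Suc n * j \<le> k.
      y (Suc n) ^ j / fact j * (fps_nth (F ^ (m - j)) (k - Suc n * j) / fact (m - j)))"
    by (subst sum.inter_filter[symmetric]) auto
  also have "\<dots> = (\<Sum>\<alpha>\<in>weighted_tuples (Suc n) m k. \<Prod>i=1..Suc n. y i ^ \<alpha> i / fact (\<alpha> i))"
    unfolding F_def Suc.IH sum_weighted_tuples_Suc[of "\<lambda>i a. y i ^ a / fact a"] ..
  finally show ?case .
qed

text \<open>Where \<open>u\<close> is analytic, this is the Taylor series in time of the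
  displacement from \<open>z\<close> along the flow of \<open>u\<close>. Index 0 is set apart
  because \<open>i - 1\<close> would truncate to 0 there and give \<open>u z\<close>.\<close>

definition vfield_fps :: "(complex \<Rightarrow> complex) \<Rightarrow> complex \<Rightarrow> complex fps" where
  "vfield_fps u z = Abs_fps (\<lambda>i. if i = 0 then 0 else (vfield u ^^ (i - 1)) u z / fact i)"

lemma vfield_fps_nth_0 [simp]: "fps_nth (vfield_fps u z) 0 = 0"
  by (simp add: vfield_fps_def)

text \<open>The partial exponential Bell polynomial with indices \<open>k\<close>, \<open>m\<close>,
  evaluated at \<open>u\<close>, \<open>A u\<close>, \<open>A (A u)\<close> and so on.\<close>

definition vfield_bell :: "(complex \<Rightarrow> complex) \<Rightarrow> nat \<Rightarrow> nat \<Rightarrow> complex \<Rightarrow> complex" where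
  "vfield_bell u k m z = fact k / fact m * fps_nth (vfield_fps u z ^ m) k"

lemma vfield_bell_eq_sum:
  "vfield_bell u k m z = (\<Sum>\<alpha>\<in>index_tuples m k.
     partition_coeff k \<alpha> * (\<Prod>i=1..k. ((vfield u ^^ (i - 1)) u z) ^ \<alpha> i))"
proof -
  define y where "y = (\<lambda>i. (vfield u ^^ (i - 1)) u z / fact i)"
  have "fps_nth (vfield_fps u z ^ m) k = fps_nth ((\<Sum>i=1..k. fps_const (y i) * fps_X ^ i) ^ m) k"
  proof (rule fps_power_nth_cong)
    fix i assume "i \<le> k"
    then show "fps_nth (vfield_fps u z) i = fps_nth (\<Sum>i=1..k. fps_const (y i) * fps_X ^ i) i"
      by (auto simp: vfield_fps_def y_def fps_sum_nth fps_X_power_nth if_distrib[of "(*) _"] cong: if_cong)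
  qed
  then have "vfield_bell u k m z =
      fact k * (\<Sum>\<alpha>\<in>weighted_tuples k m k. \<Prod>i=1..k. y i ^ \<alpha> i / fact (\<alpha> i))"
    unfolding fps_power_nth_multinomial[symmetric] vfield_bell_def by simp
  also have "weighted_tuples k m k = index_tuples m k"
    by (simp add: weighted_tuples_def index_tuples_def)
  finally show ?thesis
    by (simp add: sum_distrib_left partition_coeff_def y_def power_divide prod_dividef
        prod.distrib mult_ac)
qed

text \<open>Each coefficient of a product is a finite Cauchy sum, so the Leibniz rule applies
  termwise and no convergence in the formal variable is involved.\<close>

lemma fps_power_nth_has_field_derivative:
  fixes F :: "'a::real_normed_field \<Rightarrow> 'a fps"
  assumes "\<And>n. ((\<lambda>z. fps_nth (F z) n) has_field_derivative fps_nth F' n) (at z)"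
  shows "((\<lambda>z. fps_nth (F z ^ m) n) has_field_derivative
           fps_nth (of_nat m * F' * F z ^ (m - 1)) n) (at z)"
proof (induction m arbitrary: n)
  case (Suc m)
  have "((\<lambda>z. fps_nth (F z * F z ^ m) n) has_field_derivative
     (\<Sum>i=0..n. fps_nth F' i * fps_nth (F z ^ m) (n - i) +
        fps_nth (of_nat m * F' * F z ^ (m - 1)) (n - i) * fps_nth (F z) i)) (at z)"
    unfolding fps_mult_nth[of "F _"] by (intro DERIV_sum DERIV_mult assms Suc.IH)
  also have "(\<Sum>i=0..n. fps_nth F' i * fps_nth (F z ^ m) (n - i) +
        fps_nth (of_nat m * F' * F z ^ (m - 1)) (n - i) * fps_nth (F z) i) =
      fps_nth (F' * F z ^ m + F z * (of_nat m * F' * F z ^ (m - 1))) n"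
    by (simp add: fps_mult_nth[of F'] fps_mult_nth[of "F z"] sum.distrib mult.commute)
  also have "F' * F z ^ m + F z * (of_nat m * F' * F z ^ (m - 1)) = of_nat (Suc m) * F' * F z ^ m"
    by (cases m) (simp_all add: algebra_simps)
  finally show ?case by simp
qed simp

lemma vfield_power_holomorphic_on:
  assumes "open S" "u holomorphic_on S" "f holomorphic_on S"
  shows "(vfield u ^^ k) f holomorphic_on S"
  using assms
  by (induction k) (auto simp: vfield_def intro!: holomorphic_intros)

lemma vfield_bell_has_field_derivative:
  assumes S: "open S" "u holomorphic_on S" and z: "z \<in> S"
  obtains D where "(vfield_bell u k m has_field_derivative D) (at z)"
    and "vfield_bell u (Suc k) m z =
      u z * D + (if m = 0 then 0 else u z * vfield_bell u k (m - 1) z)"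
proof -
  define X where "X = vfield_fps u z"
  define X' where "X' = Abs_fps (\<lambda>i. deriv (\<lambda>w. fps_nth (vfield_fps u w) i) z)"
  have hol: "(vfield u ^^ i) u holomorphic_on S" for i
    using S by (intro vfield_power_holomorphic_on)
  have diff: "(vfield u ^^ i) u field_differentiable at z" for i
    using hol S z by (auto intro: holomorphic_on_imp_differentiable_at)
  have "(\<lambda>w. fps_nth (vfield_fps u w) n) field_differentiable at z" for n
    by (cases n) (auto simp: vfield_fps_def simp del: fact_Suc intro!: diff derivative_intros)
  then have "((\<lambda>w. fps_nth (vfield_fps u w) n) has_field_derivative fps_nth X' n) (at z)" for n
    by (simp add: X'_def field_differentiable_derivI)
  from fps_power_nth_has_field_derivative[OF this, of m k]
  have d: "((\<lambda>w. fps_nth (vfield_fps u w ^ m) k) has_field_derivative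
      fps_nth (of_nat m * X' * X ^ (m - 1)) k) (at z)"
    by (simp add: X_def)
  \<comment> \<open>Applying \<open>A\<close> shifts the sequence of iterates by one, as the formal
    derivative does. They differ only at index 0: the left side is 0, while
    \<open>fps_deriv X\<close> has \<open>u z\<close> there.\<close>
  have flow: "fps_const (u z) * X' = fps_deriv X - fps_const (u z)"
  proof (rule fps_ext)
    fix i
    show "fps_nth (fps_const (u z) * X') i = fps_nth (fps_deriv X - fps_const (u z)) i"
    proof (cases i)
      case (Suc j)
      have "fps_nth X' i = deriv ((vfield u ^^ j) u) z / fact (Suc j)"
        using DERIV_imp_deriv[OF DERIV_cdivide[OF field_differentiable_derivI[OF diff]]]
        by (simp add: X'_def vfield_fps_def Suc del: fact_Suc)
      moreover have "of_nat (Suc (Suc j)) * (c / fact (Suc (Suc j))) = c / fact (Suc j)" for c :: complex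
        unfolding fact_Suc[of "Suc j"] by (simp del: of_nat_Suc fact_Suc)
      then have "fps_nth (fps_deriv X) i = (vfield u ^^ Suc j) u z / fact (Suc j)"
        by (simp only: fps_deriv_nth X_def vfield_fps_def Suc fps_nth_Abs_fps) simp
      ultimately show ?thesis
        by (simp add: Suc vfield_def del: fact_Suc)
    qed (simp add: X_def X'_def vfield_fps_def)
  qed
  have "u z * fps_nth (of_nat m * X' * X ^ (m - 1)) k =
      fps_nth (fps_const (u z) * (of_nat m * X' * X ^ (m - 1))) k"
    by (simp only: fps_mult_left_const_nth)
  also have "fps_const (u z) * (of_nat m * X' * X ^ (m - 1)) =
      of_nat m * (fps_const (u z) * X') * X ^ (m - 1)"
    by (simp only: mult_ac)
  also have "\<dots> = fps_deriv (X ^ m) - of_nat m * fps_const (u z) * X ^ (m - 1)"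
    unfolding flow fps_deriv_power fps_of_nat
    by (simp only: left_diff_distrib right_diff_distrib)
  also have "of_nat m * fps_const (u z) = fps_const (of_nat m * u z)"
    by (simp flip: fps_of_nat)
  finally have r: "u z * fps_nth (of_nat m * X' * X ^ (m - 1)) k =
      of_nat (Suc k) * fps_nth (X ^ m) (Suc k) - of_nat m * u z * fps_nth (X ^ (m - 1)) k"
    by (simp del: of_nat_Suc)
  show ?thesis
  proof
    show "(vfield_bell u k m has_field_derivative
        fact k / fact m * fps_nth (of_nat m * X' * X ^ (m - 1)) k) (at z)"
      unfolding vfield_bell_def[abs_def] using d by (rule DERIV_cmult)
    have "u z * (fact k / fact m * fps_nth (of_nat m * X' * X ^ (m - 1)) k) =
        fact k / fact m * 
        (of_nat (Suc k) * fps_nth (X ^ m) (Suc k) - of_nat m * u z * fps_nth (X ^ (m - 1)) k)"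
      unfolding r [symmetric] by (simp only: mult_ac)
    \<comment> \<open>The factor \<open>Suc k\<close> turns \<open>fact k\<close> into
      \<open>fact (Suc k)\<close>, and for positive \<open>m\<close> the factor \<open>m\<close>
      turns \<open>fact m\<close> into \<open>fact (m - 1)\<close>; for \<open>m = 0\<close> the
      last term vanishes.\<close>
    also have "\<dots> = vfield_bell u (Suc k) m z - (if m = 0 then 0 else u z * vfield_bell u k (m - 1) z)"
      by (cases m) (simp_all add: vfield_bell_def X_def field_simps del: of_nat_Suc)
    finally show "vfield_bell u (Suc k) m z =
      u z * (fact k / fact m * fps_nth (of_nat m * X' * X ^ (m - 1)) k) +
      (if m = 0 then 0 else u z * vfield_bell u k (m - 1) z)"
      by simp
  qed
qed

text \<open>The series has no constant term, so its \<open>m\<close>-th power starts in degree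
  \<open>m\<close> or later.\<close>

lemma vfield_bell_eq_0: "k < m \<Longrightarrow> vfield_bell u k m z = 0"
  using startsby_zero_power_prefix[of "vfield_fps u z"] by (auto simp: vfield_bell_def)

lemma vfield_power_eq_sum_vfield_bell:
  assumes S: "open S" "u holomorphic_on S" "f holomorphic_on S" and z: "z \<in> S"
  shows "(vfield u ^^ k) f z = (\<Sum>m\<le>k. vfield_bell u k m z * (deriv ^^ m) f z)"
  using z
proof (induction k arbitrary: z)
  case 0
  then show ?case by (simp add: vfield_bell_def)
next
  case (Suc k)
  have "\<forall>m. \<exists>D. (vfield_bell u k m has_field_derivative D) (at z) \<and>
      vfield_bell u (Suc k) m z = u z * D + (if m = 0 then 0 else u z * vfield_bell u k (m - 1) z)"
    using vfield_bell_has_field_derivative[OF S(1,2) Suc.prems] by metis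
  then obtain D where D: "\<And>m. (vfield_bell u k m has_field_derivative D m) (at z)"
    and rec: "\<And>m. vfield_bell u (Suc k) m z =
      u z * D m + (if m = 0 then 0 else u z * vfield_bell u k (m - 1) z)"
    by metis
  have df: "((deriv ^^ m) f has_field_derivative (deriv ^^ Suc m) f z) (at z)" for m
    using S(1) Suc.prems holomorphic_higher_deriv[OF S(3,1), of m]
    by (auto intro!: holomorphic_derivI)
  have "((\<lambda>w. \<Sum>m\<le>k. vfield_bell u k m w * (deriv ^^ m) f w) has_field_derivative
      (\<Sum>m\<le>k. D m * (deriv ^^ m) f z + (deriv ^^ Suc m) f z * vfield_bell u k m z)) (at z)"
    by (intro DERIV_sum DERIV_mult D df)
  \<comment> \<open>Differentiating the induction hypothesis requires it near \<open>z\<close>, not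
    just at \<open>z\<close>; it is available on the whole open set \<open>S\<close>.\<close>
  then have "((vfield u ^^ k) f has_field_derivative
      (\<Sum>m\<le>k. D m * (deriv ^^ m) f z + (deriv ^^ Suc m) f z * vfield_bell u k m z)) (at z)"
    by (rule has_field_derivative_transform_within_open[OF _ S(1) Suc.prems])
      (simp add: Suc.IH)
  then have "(vfield u ^^ Suc k) f z =
      u z * (\<Sum>m\<le>k. D m * (deriv ^^ m) f z + (deriv ^^ Suc m) f z * vfield_bell u k m z)"
    by (simp add: vfield_def DERIV_imp_deriv)
  also have "\<dots> = (\<Sum>m\<le>k. u z * D m * (deriv ^^ m) f z) +
      (\<Sum>m\<le>k. u z * vfield_bell u k m z * (deriv ^^ Suc m) f z)"
    by (simp add: sum.distrib sum_distrib_left algebra_simps)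
  \<comment> \<open>The added term is 0: the Bell polynomial with \<open>m = Suc k\<close> vanishes
    identically, hence so does its derivative.\<close>
  also have "(\<Sum>m\<le>k. u z * D m * (deriv ^^ m) f z) =
      (\<Sum>m\<le>Suc k. u z * D m * (deriv ^^ m) f z)"
  proof -
    have "vfield_bell u k (Suc k) = (\<lambda>_. 0)"
      by (simp add: fun_eq_iff vfield_bell_eq_0)
    then have "D (Suc k) = 0"
      using D[of "Suc k"] by (auto intro: DERIV_unique)
    then show ?thesis by simp
  qed
  \<comment> \<open>Reindexing by \<open>m + 1\<close> brings both sums to the range and shape of
    the recurrence \<open>rec\<close>.\<close>
  also have "(\<Sum>m\<le>k. u z * vfield_bell u k m z * (deriv ^^ Suc m) f z) =
      (\<Sum>m\<le>Suc k. (if m = 0 then 0 else u z * vfield_bell u k (m - 1) z) * (deriv ^^ m) f z)"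
    by (subst sum.atMost_Suc_shift) simp
  finally show ?case
    by (simp only: rec sum.distrib [symmetric] distrib_right)
qed

lemma vfield_power_eq_expansion:
  assumes "u analytic_on {z}" "f analytic_on {z}"
  shows "(vfield u ^^ k) f z = vfield_expansion u k f z"
proof -
  obtain S T where "open S" "z \<in> S" "u holomorphic_on S" "open T" "z \<in> T" "f holomorphic_on T"
    using assms unfolding analytic_at by blast
  then have "(vfield u ^^ k) f z = (\<Sum>m\<le>k. vfield_bell u k m z * (deriv ^^ m) f z)"
    by (intro vfield_power_eq_sum_vfield_bell[of "S \<inter> T"])
      (auto intro: holomorphic_on_subset)
  then show ?thesis
    by (simp add: vfield_expansion_def vfield_bell_eq_sum sum_distrib_right atLeast0AtMost)
qed

theorem theorem2p2:
  fixes u f :: "complex \<Rightarrow> complex" and k :: nat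
  assumes "u meromorphic_on UNIV" and "f meromorphic_on UNIV" and "k \<ge> 1"
  shows "(\<forall>\<^sub>\<approx>z. (vfield u ^^ k) f z = vfield_expansion u k f z) \<and>
         (\<forall>z. u analytic_on {z} \<longrightarrow> f analytic_on {z} \<longrightarrow>
              (vfield u ^^ k) f z = vfield_expansion u k f z)"
proof
  \<comment> \<open>Meromorphic functions are analytic off a sparse set, so the identity at common
    points of analyticity gives the cosparse one.\<close>
  have "\<forall>\<^sub>\<approx>z. u analytic_on {z}" "\<forall>\<^sub>\<approx>z. f analytic_on {z}"
    using assms(1,2) by (auto intro: meromorphic_on_imp_analytic_cosparse)
  then show "\<forall>\<^sub>\<approx>z. (vfield u ^^ k) f z = vfield_expansion u k f z"
    by eventually_elim (rule vfield_power_eq_expansion)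
qed (blast intro: vfield_power_eq_expansion)

end
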